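(* Let $G_\tau$ be a bidirected graph and $\mathrm{Rt}(G_\tau)$ a transitive reduction of $G_\tau$. Then (i) $\mathrm{Rt}(G_\tau)$ is balanced if, and only if, $G_\tau$ is balanced; (ii) $\mathrm{Rt}(G_\tau)$ is all positive if, and only if, $G_\tau$ is all positive.
   Context: A graph $G=(V,E)$ is finite, with loops and multiple edges allowed. A half-edge is a pair $(e,x)$ with $e$ incident with $x$ (a loop has two half-edges at its vertex). A bidirected graph $G_\tau=(V,E;\tau)$ is a graph with a map $\tau$ assigning $+1$ or $-1$ to every half-edge; an edge with ends $x,y$ and $\tau(e,x)=\alpha,\tau(e,y)=\beta$ is written $\{x^\alpha,y^\beta\}$ and has sign $-\alpha\beta$. A bidirected graph is all positive if all its edges have sign $+1$, and balanced if every cycle has an even number of negative edges. A partial graph of $G_\tau$ is $(V,F;\tau|_F)$ with $F\subseteq E$. A chain is $x_0,e_1,x_1,\ldots,e_k,x_k$ where $e_i$ has ends $x_{i-1},x_i$; when $e_i$ is traversed from $x_{i-1}$ to $x_i$, $\tau(e_i,x_{i-1}),\tau(e_i,x_i)$ denote the values at the corresponding half-edges. For $\alpha,\beta\in\{\pm1\}$ a b-walk from $x^\alpha$ to $y^\beta$ is a chain $x=x_0,e_1,\ldots,e_k,x_k=y$ with $k\ge1$, $\tau(e_1,x_0)=\alpha$, $\tau(e_k,x_k)=\beta$ and $\tau(e_i,x_i)+\tau(e_{i+1},x_i)=0$ for $1\le i\le k-1$. A b-path from $x^\alpha$ to $y^\beta$ is a b-walk from $x^\alpha$ to $y^\beta$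 minimal with these properties (no b-walk from $x^\alpha$ to $y^\beta$ has as edge sequence a proper subsequence, in the same order, of its edge sequence); $x=y$ allowed. For a partial graph $H_\tau$ of $G_\tau$, $\mathrm{ft}(G_\tau;H_\tau)$ is the partial graph of $G_\tau$ whose edges are the edges of $G_\tau$ that are edges of $H_\tau$ or are of the form $\{x^\alpha,y^\beta\}$ with a b-path from $x^\alpha$ to $y^\beta$ in $H_\tau$. A transitive reduction of $G_\tau$ is a minimal partial graph $R$ of $G_\tau$ with $\mathrm{ft}(G_\tau;R)=G_\tau$. *)

theory Defs
  imports Main "HOL-Library.Sublist"
begin

text \<open>
  The two half-edges of an edge \<open>e\<close> are \<open>(e, True)\<close> and \<open>(e, False)\<close>; the half-edge \<open>(e, b)\<close>
  lies at the vertex \<open>inc G e b\<close>. A loop thus has two half-edges at its vertex, possibly with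
  different values of \<open>tau\<close>. The values of \<open>inc\<close> and \<open>tau\<close> outside \<open>edges G\<close> are irrelevant.
\<close>

record ('v, 'e) bigraph =
  verts :: "'v set"
  edges :: "'e set"
  inc :: "'e \<Rightarrow> bool \<Rightarrow> 'v"
  tau :: "'e \<Rightarrow> bool \<Rightarrow> int"

locale bidirected_graph =
  fixes G :: "('v, 'e) bigraph"
  assumes finite_verts: "finite (verts G)"
    and finite_edges: "finite (edges G)"
    and inc_in_verts: "e \<in> edges G \<Longrightarrow> inc G e b \<in> verts G"
    and tau_values: "e \<in> edges G \<Longrightarrow> tau G e b \<in> {1, -1}"

definition edge_sign :: "('v, 'e) bigraph \<Rightarrow> 'e \<Rightarrow> int" where
  "edge_sign G e = - (tau G e True * tau G e False)"

definition all_positive :: "('v, 'e) bigraph \<Rightarrow> bool" where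
  "all_positive G \<longleftrightarrow> (\<forall>e \<in> edges G. edge_sign G e = 1)"

definition partial_graph :: "('v, 'e) bigraph \<Rightarrow> ('v, 'e) bigraph \<Rightarrow> bool" where
  "partial_graph H G \<longleftrightarrow> (\<exists>F \<subseteq> edges G. H = G\<lparr>edges := F\<rparr>)"

text \<open>
  A chain is given by its traversed edges: the pair \<open>(e, b)\<close> is the traversal of \<open>e\<close> that starts
  at the half-edge \<open>(e, b)\<close> and arrives at the half-edge \<open>(e, \<not> b)\<close>.
\<close>

fun chain :: "('v, 'e) bigraph \<Rightarrow> 'v \<Rightarrow> ('e \<times> bool) list \<Rightarrow> 'v \<Rightarrow> bool" where
  "chain G x [] y \<longleftrightarrow> x \<in> verts G \<and> x = y"
| "chain G x ((e, b) # ds) y \<longleftrightarrow>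
     e \<in> edges G \<and> inc G e b = x \<and> chain G (inc G e (\<not> b)) ds y"

definition src :: "('v, 'e) bigraph \<Rightarrow> 'e \<times> bool \<Rightarrow> 'v" where
  "src G d = inc G (fst d) (snd d)"

definition tau_src :: "('v, 'e) bigraph \<Rightarrow> 'e \<times> bool \<Rightarrow> int" where
  "tau_src G d = tau G (fst d) (snd d)"

definition tau_tgt :: "('v, 'e) bigraph \<Rightarrow> 'e \<times> bool \<Rightarrow> int" where
  "tau_tgt G d = tau G (fst d) (\<not> snd d)"

text \<open>Loops are cycles of length 1, and pairs of parallel edges are cycles of length 2.\<close>

definition is_cycle :: "('v, 'e) bigraph \<Rightarrow> ('e \<times> bool) list \<Rightarrow> bool" where
  "is_cycle G ds \<longleftrightarrow>
     ds \<noteq> [] \<and> (\<exists>x. chain G x ds x) \<and> distinct (map (src G) ds) \<and> distinct (map fst ds)"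

definition balanced :: "('v, 'e) bigraph \<Rightarrow> bool" where
  "balanced G \<longleftrightarrow>
     (\<forall>ds. is_cycle G ds \<longrightarrow> even (card {e \<in> fst ` set ds. edge_sign G e = -1}))"

definition b_walk ::
    "('v, 'e) bigraph \<Rightarrow> 'v \<Rightarrow> int \<Rightarrow> ('e \<times> bool) list \<Rightarrow> 'v \<Rightarrow> int \<Rightarrow> bool" where
  "b_walk G x \<alpha> ds y \<beta> \<longleftrightarrow>
     ds \<noteq> [] \<and> chain G x ds y \<and> tau_src G (hd ds) = \<alpha> \<and> tau_tgt G (last ds) = \<beta> \<and>
     (\<forall>i. Suc i < length ds \<longrightarrow> tau_tgt G (ds ! i) + tau_src G (ds ! Suc i) = 0)"

definition b_path ::
    "('v, 'e) bigraph \<Rightarrow> 'v \<Rightarrow> int \<Rightarrow> ('e \<times> bool) list \<Rightarrow> 'v \<Rightarrow> int \<Rightarrow> bool" where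
  "b_path G x \<alpha> ds y \<beta> \<longleftrightarrow>
     b_walk G x \<alpha> ds y \<beta> \<and>
     \<not> (\<exists>ds'. b_walk G x \<alpha> ds' y \<beta> \<and> strict_subseq (map fst ds') (map fst ds))"

text \<open>\<open>e\<close> is of the form \<open>{x\<^sup>\<alpha>, y\<^sup>\<beta>}\<close>; the existential over \<open>b\<close> makes the pair of ends unordered.\<close>

definition has_form :: "('v, 'e) bigraph \<Rightarrow> 'e \<Rightarrow> 'v \<Rightarrow> int \<Rightarrow> 'v \<Rightarrow> int \<Rightarrow> bool" where
  "has_form G e x \<alpha> y \<beta> \<longleftrightarrow>
     (\<exists>b. inc G e b = x \<and> tau G e b = \<alpha> \<and> inc G e (\<not> b) = y \<and> tau G e (\<not> b) = \<beta>)"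

definition ft :: "('v, 'e) bigraph \<Rightarrow> ('v, 'e) bigraph \<Rightarrow> ('v, 'e) bigraph" where
  "ft G H = G\<lparr>edges := {e \<in> edges G. e \<in> edges H \<or>
     (\<exists>x \<alpha> y \<beta>. has_form G e x \<alpha> y \<beta> \<and> (\<exists>ds. b_path H x \<alpha> ds y \<beta>))}\<rparr>"

definition transitive_reduction :: "('v, 'e) bigraph \<Rightarrow> ('v, 'e) bigraph \<Rightarrow> bool" where
  "transitive_reduction G R \<longleftrightarrow>
     partial_graph R G \<and> ft G R = G \<and>
     (\<forall>R'. partial_graph R' R \<and> ft G R' = G \<longrightarrow> R' = R)"

end

theory Submission
  imports Defs
begin

text \<open>
  Since consecutive half-edges of a b-walk have opposite values, the signs along a b-walk from
  \<open>x\<^sup>\<alpha>\<close> to \<open>y\<^sup>\<beta>\<close> telescope to \<open>-\<alpha>\<beta>\<close>, the sign of an edge \<open>{x\<^sup>\<alpha>, y\<^sup>\<beta>}\<close>. Hence every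
  edge of the graph can be replaced by a chain of the reduction with the same ends and the same sign.
  This gives (ii) directly, and (i) because a graph is balanced iff all its closed chains, not only
  its cycles, have sign 1.
\<close>

section \<open>Signs of chains and splitting of lists\<close>

text \<open>An edge counts once per traversal, which makes the sign multiplicative under
  concatenation; an edge traversed twice contributes 1.\<close>

definition chain_sign :: "('v, 'e) bigraph \<Rightarrow> ('e \<times> bool) list \<Rightarrow> int" where
  "chain_sign G ds = (\<Prod>d\<leftarrow>ds. edge_sign G (fst d))"

lemma chain_sign_simps [simp]:
  "chain_sign G [] = 1"
  "chain_sign G (d # ds) = edge_sign G (fst d) * chain_sign G ds"
  "chain_sign G (ds @ ds') = chain_sign G ds * chain_sign G ds'"
  by (simp_all add: chain_sign_def)

text \<open>Provides the cut points of a closed chain that is not a cycle: \<open>f\<close> will be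
  \<open>src G\<close> for a repeated vertex and \<open>fst\<close> for a repeated edge.\<close>

lemma not_distinct_map_decomp:
  assumes "\<not> distinct (map f xs)"
  obtains ps x qs y rs where "xs = ps @ [x] @ qs @ [y] @ rs" and "f x = f y"
proof -
  have "\<exists>ps x qs y rs. xs = ps @ [x] @ qs @ [y] @ rs \<and> f x = f y"
    using assms
  proof (induction xs)
    case Nil
    then show ?case by simp
  next
    case (Cons a xs)
    show ?case
    proof (cases "f a \<in> f ` set xs")
      case True
      then obtain y where y: "y \<in> set xs" "f a = f y" by auto
      then obtain qs rs where "xs = qs @ y # rs" by (meson split_list)
      with y(2) show ?thesis
        by (intro exI[of _ "[]"] exI[of _ a] exI[of _ qs] exI[of _ y] exI[of _ rs]) simp
    next
      case False
      with Cons obtain ps x qs y rs where "xs = ps @ [x] @ qs @ [y] @ rs" "f x = f y" by auto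
      then show ?thesis
        by (intro exI[of _ "a # ps"] exI[of _ x] exI[of _ qs] exI[of _ y] exI[of _ rs]) simp
    qed
  qed
  then show ?thesis using that by blast
qed

text \<open>Turns the indexed condition on consecutive half-edges into a recursion, so that b-walks
  can be treated by induction on the list.\<close>

lemma b_walk_Cons_Cons:
  "b_walk G x \<alpha> (d # d' # ds) y \<beta> \<longleftrightarrow>
     fst d \<in> edges G \<and> inc G (fst d) (snd d) = x \<and> tau_src G d = \<alpha> \<and>
     tau_tgt G d + tau_src G d' = 0 \<and>
     b_walk G (inc G (fst d) (\<not> snd d)) (tau_src G d') (d' # ds) y \<beta>"
  by (cases d) (auto simp: b_walk_def nth_Cons split: nat.splits)

section \<open>Chains and b-walks in a bidirected graph\<close>

context bidirected_graph
begin

lemma edge_sign_values: "e \<in> edges G \<Longrightarrow> edge_sign G e = 1 \<or> edge_sign G e = -1"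
  using tau_values[of e True] tau_values[of e False] by (auto simp: edge_sign_def)

lemma edge_sign_square: "e \<in> edges G \<Longrightarrow> edge_sign G e * edge_sign G e = 1"
  using edge_sign_values[of e] by auto

lemma chain_verts: "chain G x ds y \<Longrightarrow> x \<in> verts G"
  by (cases ds) (auto simp: inc_in_verts)

lemma chain_edges: "chain G x ds y \<Longrightarrow> fst ` set ds \<subseteq> edges G"
  by (induction ds arbitrary: x) fastforce+

lemma chain_append: "chain G x (ds @ ds') y \<longleftrightarrow> (\<exists>z. chain G x ds z \<and> chain G z ds' y)"
  by (induction ds arbitrary: x) (auto dest: chain_verts)

lemma chain_Cons:
  "chain G x (d # ds) y \<longleftrightarrow>
     fst d \<in> edges G \<and> src G d = x \<and> chain G (inc G (fst d) (\<not> snd d)) ds y"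
  by (cases d) (simp add: src_def)

text \<open>Needed because \<open>has_form\<close> leaves the ends of an edge unordered: the b-path
  replacing an edge may run against the wanted direction.\<close>

lemma chain_reverse:
  "chain G x ds y \<Longrightarrow> \<exists>ds'. chain G y ds' x \<and> chain_sign G ds' = chain_sign G ds"
proof (induction ds arbitrary: x)
  case Nil
  then show ?case by (auto intro: exI[of _ "[]"])
next
  case (Cons d ds)
  obtain e b where d: "d = (e, b)" by force
  with Cons.prems have e: "e \<in> edges G" "inc G e b = x" and c: "chain G (inc G e (\<not> b)) ds y"
    by auto
  obtain ds' where ds': "chain G y ds' (inc G e (\<not> b))" "chain_sign G ds' = chain_sign G ds"
    using Cons.IH[OF c] by blast
  have "chain G (inc G e (\<not> b)) [(e, \<not> b)] x"
    using e inc_in_verts by auto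
  then have "chain G y (ds' @ [(e, \<not> b)]) x"
    using ds'(1) chain_append by blast
  then show ?case
    using ds'(2) d by (intro exI[of _ "ds' @ [(e, \<not> b)]"]) simp
qed

lemma chain_sign_b_walk:
  "b_walk G x \<alpha> ds y \<beta> \<Longrightarrow> chain_sign G ds = - (\<alpha> * \<beta>)"
proof (induction ds arbitrary: x \<alpha>)
  case Nil
  then show ?case by (simp add: b_walk_def)
next
  case (Cons d ds)
  show ?case
  proof (cases ds)
    case Nil
    with Cons.prems show ?thesis
      by (cases "snd d") (auto simp: b_walk_def tau_src_def tau_tgt_def edge_sign_def)
  next
    case (Cons d' ds')
    with Cons.prems have w: "fst d \<in> edges G" "tau_src G d = \<alpha>" "tau_tgt G d = - tau_src G d'"
      "b_walk G (inc G (fst d) (\<not> snd d)) (tau_src G d') ds y \<beta>"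
      by (auto simp: b_walk_Cons_Cons)
    have "edge_sign G (fst d) = - (tau_src G d * tau_tgt G d)"
      by (cases "snd d") (auto simp: edge_sign_def tau_src_def tau_tgt_def)
    \<comment> \<open>The remaining walk starts with the value \<open>- tau_tgt G d\<close>, so the
      inner value occurs twice in the product and cancels.\<close>
    moreover have "tau_tgt G d * tau_tgt G d = 1"
      using tau_values[OF w(1), of "\<not> snd d"] by (auto simp: tau_tgt_def)
    moreover have "chain_sign G ds = tau_tgt G d * \<beta>"
      using Cons.IH[OF w(4)] w(3) by simp
    ultimately show ?thesis
      using w(2) by (simp add: algebra_simps)
  qed
qed

text \<open>Without repeated edges the product over the list is a product over the edge set, hence
  -1 to the number of negative edges.\<close>

lemma even_negative_edges_iff:
  assumes "fst ` set ds \<subseteq> edges G" and "distinct (map fst ds)"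
  shows "even (card {e \<in> fst ` set ds. edge_sign G e = -1}) \<longleftrightarrow> chain_sign G ds = 1"
proof -
  let ?N = "{e \<in> fst ` set ds. edge_sign G e = -1}"
  have "chain_sign G ds = (\<Prod>e\<in>fst ` set ds. edge_sign G e)"
    using prod.distinct_set_conv_list[OF assms(2), of "edge_sign G"]
    by (simp add: chain_sign_def comp_def)
  also have "\<dots> = (\<Prod>e\<in>fst ` set ds. if edge_sign G e = -1 then -1 else 1)"
    using assms(1) edge_sign_values by (intro prod.cong) auto
  also have "\<dots> = (\<Prod>e\<in>?N. -1)"
    by (rule prod.inter_filter[symmetric]) simp
  also have "\<dots> = (-1) ^ card ?N"
    by simp
  finally show ?thesis
    by (cases "even (card ?N)") simp_all
qed

text \<open>Strong induction on the length: a nonempty closed chain that is not a cycle repeats a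
  vertex or an edge, and cutting there leaves two shorter closed chains. Their base vertices may
  differ from \<open>x\<close>, so \<open>x\<close> is arbitrary.\<close>

lemma balanced_closed_chain_sign:
  assumes "balanced G"
  shows "chain G x ds x \<Longrightarrow> chain_sign G ds = 1"
proof (induction ds arbitrary: x rule: length_induct)
  case (1 ds)
  then have IH: "\<And>ds' z. length ds' < length ds \<Longrightarrow> chain G z ds' z \<Longrightarrow> chain_sign G ds' = 1"
    and c: "chain G x ds x" by blast+
  consider "ds = []" | "is_cycle G ds" | "\<not> distinct (map (src G) ds)"
    | "distinct (map (src G) ds)" "\<not> distinct (map fst ds)"
    using c by (auto simp: is_cycle_def)
  then show ?case
  proof cases
    case 1
    then show ?thesis by simp
  next
    case 2
    then show ?thesis
      using assms even_negative_edges_iff[OF chain_edges[OF c]]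
      by (auto simp: balanced_def is_cycle_def)
  next
    case 3
    then obtain ps d qs d' rs where ds: "ds = ps @ [d] @ qs @ [d'] @ rs" and eq: "src G d = src G d'"
      by (rule not_distinct_map_decomp)
    from c obtain "chain G x ps (src G d)" "chain G (src G d) (d # qs) (src G d')"
      "chain G (src G d') (d' # rs) x"
      unfolding ds by (auto simp: chain_append chain_Cons)
    \<comment> \<open>Both traversals start at the same vertex, so the segment \<open>d # qs\<close>
      is itself closed and can be bypassed.\<close>
    then have "chain G x (ps @ d' # rs) x" "chain G (src G d) (d # qs) (src G d)"
      unfolding chain_append using eq by auto
    from this[THEN IH[rotated]]
    have "chain_sign G (ps @ d' # rs) = 1" "chain_sign G (d # qs) = 1"
      by (simp_all add: ds)
    moreover have "chain_sign G ds = chain_sign G (ps @ d' # rs) * chain_sign G (d # qs)"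
      by (simp add: ds)
    ultimately show ?thesis by (simp only: mult_1)
  next
    case 4
    then obtain ps d qs d' rs where ds: "ds = ps @ [d] @ qs @ [d'] @ rs" and eq: "fst d = fst d'"
      using not_distinct_map_decomp[OF 4(2)] by blast
    \<comment> \<open>Two traversals in the same direction would have equal sources, against the
      distinctness in this case.\<close>
    have "snd d' = (\<not> snd d)"
      using 4(1) eq by (auto simp: ds src_def)
    \<comment> \<open>The edge is traversed once in each direction, so both traversals can be cut out.\<close>
    with c eq obtain "chain G x ps (src G d)" "chain G (src G d') qs (src G d')"
      "chain G (src G d) rs x" "fst d \<in> edges G"
      unfolding ds by (auto simp: chain_append chain_Cons src_def)
    then have "chain G x (ps @ rs) x" "chain G (src G d') qs (src G d')"
      and e: "edge_sign G (fst d) * edge_sign G (fst d) = 1"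
      unfolding chain_append using edge_sign_square by auto
    from this(1,2)[THEN IH[rotated]] have "chain_sign G (ps @ rs) = 1" "chain_sign G qs = 1"
      by (simp_all add: ds)
    moreover have "chain_sign G ds = chain_sign G (ps @ rs) * chain_sign G qs *
        (edge_sign G (fst d) * edge_sign G (fst d))"
      using eq by (simp add: ds)
    ultimately show ?thesis using e by (simp only: mult_1)
  qed
qed

section \<open>Passing to a partial graph\<close>

lemma bidirected_graph_subset:
  "F \<subseteq> edges G \<Longrightarrow> bidirected_graph (G\<lparr>edges := F\<rparr>)"
  using finite_verts finite_edges inc_in_verts tau_values
  by unfold_locales (simp_all add: subset_iff finite_subset)

end

lemma edge_sign_update_edges [simp]: "edge_sign (G\<lparr>edges := F\<rparr>) = edge_sign G"
  by (simp add: edge_sign_def fun_eq_iff)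

lemma src_update_edges [simp]: "src (G\<lparr>edges := F\<rparr>) = src G"
  by (simp add: src_def fun_eq_iff)

lemma chain_sign_update_edges [simp]: "chain_sign (G\<lparr>edges := F\<rparr>) = chain_sign G"
  by (simp add: chain_sign_def fun_eq_iff)

lemma chain_update_edges_mono:
  "F \<subseteq> edges G \<Longrightarrow> chain (G\<lparr>edges := F\<rparr>) x ds y \<Longrightarrow> chain G x ds y"
  by (induction ds arbitrary: x) auto

lemma balanced_subset:
  "F \<subseteq> edges G \<Longrightarrow> balanced G \<Longrightarrow> balanced (G\<lparr>edges := F\<rparr>)"
  unfolding balanced_def is_cycle_def
  by (auto dest: chain_update_edges_mono)

lemma all_positive_chain_sign:
  "all_positive G \<Longrightarrow> chain G x ds y \<Longrightarrow> chain_sign G ds = 1"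
  by (induction ds arbitrary: x) (auto simp: all_positive_def)

section \<open>Replacing edges by chains of the partial graph\<close>

context bidirected_graph
begin

lemma ft_edge_chain:
  assumes "F \<subseteq> edges G" and "ft G (G\<lparr>edges := F\<rparr>) = G" and "e \<in> edges G"
  shows "\<exists>ds. chain (G\<lparr>edges := F\<rparr>) (inc G e b) ds (inc G e (\<not> b)) \<and>
    chain_sign G ds = edge_sign G e"
proof (cases "e \<in> F")
  case True
  then show ?thesis
    using inc_in_verts[OF assms(3)] by (intro exI[of _ "[(e, b)]"]) simp
next
  case False
  let ?R = "G\<lparr>edges := F\<rparr>"
  interpret R: bidirected_graph ?R
    by (rule bidirected_graph_subset[OF assms(1)])
  have "e \<in> edges (ft G ?R)"
    using assms(2,3) by simp
  \<comment> \<open>An edge outside \<open>F\<close> lies in \<open>ft\<close> only through a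
    b-path; \<open>b'\<close> marks the half-edge whose end and value the path starts with.\<close>
  with False obtain b' ds where w:
    "b_walk ?R (inc G e b') (tau G e b') ds (inc G e (\<not> b')) (tau G e (\<not> b'))"
    by (auto simp: ft_def has_form_def b_path_def)
  then have c: "chain ?R (inc G e b') ds (inc G e (\<not> b'))"
    by (simp add: b_walk_def)
  have s: "chain_sign G ds = edge_sign G e"
    using R.chain_sign_b_walk[OF w] by (cases b') (simp_all add: edge_sign_def)
  show ?thesis
  proof (cases "b' = b")
    case True
    with c s show ?thesis by auto
  next
    case False
    then have "b' = (\<not> b)" by simp
    with R.chain_reverse[OF c] s show ?thesis by simp
  qed
qed

text \<open>The replacements of the single edges keep their ends, so they concatenate, and their
  signs multiply.\<close>

lemma ft_chain:
  assumes "F \<subseteq> edges G" and "ft G (G\<lparr>edges := F\<rparr>) = G"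
  shows "chain G x ds y \<Longrightarrow>
    \<exists>ds'. chain (G\<lparr>edges := F\<rparr>) x ds' y \<and> chain_sign G ds' = chain_sign G ds"
proof (induction ds arbitrary: x)
  case Nil
  then show ?case by (intro exI[of _ "[]"]) auto
next
  case (Cons d ds)
  interpret R: bidirected_graph "G\<lparr>edges := F\<rparr>"
    by (rule bidirected_graph_subset[OF assms(1)])
  obtain e b where d: "d = (e, b)" by force
  with Cons.prems have e: "e \<in> edges G" "inc G e b = x" and c: "chain G (inc G e (\<not> b)) ds y"
    by auto
  obtain ds1 ds2 where "chain (G\<lparr>edges := F\<rparr>) x ds1 (inc G e (\<not> b))"
    "chain_sign G ds1 = edge_sign G e"
    "chain (G\<lparr>edges := F\<rparr>) (inc G e (\<not> b)) ds2 y" "chain_sign G ds2 = chain_sign G ds"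
    using ft_edge_chain[OF assms e(1), of b] Cons.IH[OF c] e(2) by auto
  then show ?case
    using d by (intro exI[of _ "ds1 @ ds2"]) (auto simp: R.chain_append)
qed

end

theorem theorem39:
  fixes G Rt :: "('v, 'e) bigraph"
  assumes "bidirected_graph G"
    and "transitive_reduction G Rt"
  shows "(balanced Rt \<longleftrightarrow> balanced G) \<and> (all_positive Rt \<longleftrightarrow> all_positive G)"
proof -
  interpret bidirected_graph G by fact
  obtain F where F: "F \<subseteq> edges G" and Rt: "Rt = G\<lparr>edges := F\<rparr>" and ft: "ft G (G\<lparr>edges := F\<rparr>) = G"
    using assms(2) by (auto simp: transitive_reduction_def partial_graph_def)
  interpret R: bidirected_graph Rt
    unfolding Rt by (rule bidirected_graph_subset[OF F])
  have "balanced G" if bal: "balanced Rt"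
    unfolding balanced_def
  proof (intro allI impI)
    fix ds
    assume "is_cycle G ds"
    then obtain x where c: "chain G x ds x" and d: "distinct (map fst ds)"
      by (auto simp: is_cycle_def)
    \<comment> \<open>The replacement of a cycle is closed but may repeat vertices and edges, so
      balance of \<open>Rt\<close> is used in its form for all closed chains.\<close>
    obtain ds' where ds': "chain Rt x ds' x" "chain_sign G ds' = chain_sign G ds"
      using ft_chain[OF F ft c] Rt by blast
    have "chain_sign G ds = 1"
      using R.balanced_closed_chain_sign[OF bal ds'(1)] ds'(2) Rt by simp
    then show "even (card {e \<in> fst ` set ds. edge_sign G e = -1})"
      using even_negative_edges_iff[OF chain_edges[OF c] d] by blast
  qed
  moreover have "balanced Rt" if "balanced G"
    using balanced_subset[OF F that] Rt by simp
  moreover have "all_positive G" if pos: "all_positive Rt"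
    unfolding all_positive_def
  proof
    fix e
    assume "e \<in> edges G"
    \<comment> \<open>Every chain of an all positive graph has sign 1, and this one carries the sign
      of \<open>e\<close>.\<close>
    then obtain ds where "chain Rt (inc G e True) ds (inc G e False)"
      "chain_sign G ds = edge_sign G e"
      using ft_edge_chain[OF F ft, of e True] Rt by auto
    then show "edge_sign G e = 1"
      using all_positive_chain_sign[OF pos] Rt by force
  qed
  moreover have "all_positive Rt" if "all_positive G"
    using that F Rt by (auto simp: all_positive_def)
  ultimately show ?thesis by blast
qed

end
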